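(* Write $L_1(x)=\ln(x)$ and $L_2(x)=\ln(\ln(x))$, and let $x^*$ and $x^{**}$ be the constants defined in the context. Then the following hold. (1) For $x>e$ near and far from $e$ the comparison between $L_1-L_2+\frac{L_2}{L_1}$ and $\mathrm{W}_0$ is as follows: $$L_1(x)-L_2(x)+\frac{L_2(x)}{L_1(x)}>\mathrm{W}_0(x)\quad\text{for } x\in(e,x^* ),$$ $$L_1(x)-L_2(x)+\frac{L_2(x)}{L_1(x)}=\mathrm{W}_0(x)\quad\text{for } x\in\{e,x^*\},$$ $$L_1(x)-L_2(x)+\frac{L_2(x)}{L_1(x)}<\mathrm{W}_0(x)\quad\text{for } x\in(x^*,+\infty).$$ (2) For every $x\in(x^*,+\infty)$, $$\mathrm{W}_0(x)<L_1(x)-L_2(x)+\frac{L_2(x)}{L_1(x)}+\frac{(L_2(x)-2)L_2(x)}{2L_1(x)^2}+\frac{L_2(x)^3}{L_1(x)^3}.$$ (3) For every $x\in(x^{**},+\infty)$, $$L_1(x)-L_2(x)+\frac{L_2(x)}{L_1(x)}<L_1(x)-L_2(x)+\frac{L_2(x)}{L_1(x)}+\frac{(L_2(x)-2)L_2(x)}{2L_1(x)^2}-\frac{3L_2(x)^2}{2L_1(x)^3}<\mathrm{W}_0(x),$$ and the smallest number $x_0>e$ such that the first of these two inequalities holds for all $x\in(x_0,+\infty)$ is $x_0=x^{**}$.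
   Context: $\mathrm{W}_0:[-1/e,\infty)\to[-1,\infty)$ is the principal real branch of the Lambert function: $\mathrm{W}_0(x)$ is the unique $w\ge -1$ with $we^w=x$. The constant $x^*$: for $y\ge 1$ set $f_1(y)=y^{1/y}\left(y^2-y\ln(y)+\ln(y)\right)-y^2$. There is a unique $y^*>1$ with $f_1(y^* )=0$; define $x^*=e^{y^*}\approx 6288.69$. The constant $x^{**}$: for $y\ge1$ set $f_2(y)=(y-3)\ln(y)-2y$. There is a unique $y^{**}>1$ with $f_2(y^{**})=0$; define $x^{**}=e^{y^{**}}\approx 573967.06$. *)

theory Defs
  imports "HOL-Analysis.Analysis"
begin

text \<open>The principal real branch of the Lambert function; meaningful for \<open>x \<ge> - 1 / e\<close>,
  unspecified below.\<close>

definition W0 :: "real \<Rightarrow> real" where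
  "W0 x = (THE w. w \<ge> -1 \<and> w * exp w = x)"

definition L1 :: "real \<Rightarrow> real" where
  "L1 x = ln x"

definition L2 :: "real \<Rightarrow> real" where
  "L2 x = ln (ln x)"

text \<open>The functions \<open>f1\<close> and \<open>f2\<close> are only considered for \<open>y \<ge> 1\<close>. Both vanish at exactly
  one point \<open>y > 1\<close>, so the definite descriptions below denote these points. The side condition
  \<open>y > 1\<close> is essential for \<open>f1\<close>, which also vanishes at \<open>1\<close>.\<close>

definition f1 :: "real \<Rightarrow> real" where
  "f1 y = y powr (1 / y) * (y\<^sup>2 - y * ln y + ln y) - y\<^sup>2"

definition f2 :: "real \<Rightarrow> real" where
  "f2 y = (y - 3) * ln y - 2 * y"

definition x_star :: real where
  "x_star = exp (THE y. y > 1 \<and> f1 y = 0)"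

definition x_star_star :: real where
  "x_star_star = exp (THE y. y > 1 \<and> f2 y = 0)"

end

theory Submission
  imports Defs
begin

text \<open>
  Put \<open>y = ln x\<close>, \<open>l = ln y\<close>, \<open>u = l / y\<close> and \<open>q = 1 / y\<close>. Since \<open>w \<mapsto> w exp w\<close> increases,
  a positive approximation \<open>y - l + P\<close> lies above (below) \<open>W0 x\<close> exactly when \<open>(y - l + P) / y\<close>
  lies above (below) \<open>exp (- P)\<close>.

  For \<open>P = u\<close> this comparison is the sign of \<open>f1 y\<close>, equivalently of \<open>1 - l \<phi>(u)\<close> with
  \<open>\<phi>(u) = (exp (- u) - 1 + u) / u\<^sup>2\<close>. As \<open>\<phi>\<close> is decreasing and at most \<open>1 / 2\<close>, and \<open>u\<close> decreases
  once \<open>l \<ge> 1\<close>, the quantity \<open>l \<phi>(u)\<close> reaches \<open>1\<close> exactly once, at some \<open>l \<ge> 2\<close>.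

  For the refined approximations \<open>(y - l + P) / y = 1 - u + q P\<close>, so Taylor bounds for \<open>exp (- P)\<close>
  leave polynomial inequalities in \<open>u\<close> and \<open>q\<close>; these hold as soon as \<open>l > 2\<close>, which gives
  \<open>u \<le> 1 / 3\<close>, \<open>q < 1 / 7\<close> and \<open>q \<le> u / 2\<close>.
\<close>

section \<open>Elementary bounds for the exponential\<close>

lemma exp_minus_le_quadratic:
  fixes x :: real
  assumes "x \<ge> 0"
  shows "exp (- x) \<le> 1 - x + x\<^sup>2 / 2"
proof -
  have pos: "1 - x + x\<^sup>2 / 2 > 0"
    using zero_le_power2[of "1 - x"] unfolding power2_diff by simp
  \<comment> \<open>The product equals 1 + x^4 / 4.\<close>
  have "1 \<le> (1 - x + x\<^sup>2 / 2) * (1 + x + x\<^sup>2 / 2)"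
    using assms by (simp add: field_simps power2_eq_square)
  also have "\<dots> \<le> (1 - x + x\<^sup>2 / 2) * exp x"
    using pos exp_lower_Taylor_quadratic[OF assms] by (intro mult_left_mono) auto
  finally show ?thesis
    by (simp add: exp_minus field_simps)
qed

text \<open>Multiplying the Taylor polynomial of exp (- x) by exp x makes the derivative telescope:
  only the top term survives, as - x^3 / 6 * exp x.\<close>

lemma exp_minus_ge_cubic:
  fixes x :: real
  assumes "x \<ge> 0"
  shows "1 - x + x\<^sup>2 / 2 - x ^ 3 / 6 \<le> exp (- x)"
proof -
  let ?g = "\<lambda>x::real. (1 - x + x\<^sup>2 / 2 - x ^ 3 / 6) * exp x"
  have "?g x \<le> ?g 0"
  proof (rule DERIV_nonpos_imp_nonincreasing[OF assms])
    fix t :: real assume "0 \<le> t" "t \<le> x"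
    have "(?g has_real_derivative - (t ^ 3 / 6) * exp t) (at t)"
      by (auto intro!: derivative_eq_intros simp: field_simps power2_eq_square power3_eq_cube)
    moreover have "- (t ^ 3 / 6) * exp t \<le> 0"
      using \<open>0 \<le> t\<close> by simp
    ultimately show "\<exists>d. (?g has_real_derivative d) (at t) \<and> d \<le> 0"
      by blast
  qed
  then show ?thesis
    by (simp add: exp_minus field_simps)
qed

text \<open>This decides the sign of the derivative of \<open>exp_remainder\<close> below. The
  difference of the two sides vanishes at 0, and its derivative is positive because 1 - t < exp (-
  t).\<close>

lemma two_minus_mult_exp_less:
  fixes u :: real
  assumes "u > 0"
  shows "(2 - u) * exp u < 2 + u"
proof -
  let ?g = "\<lambda>u::real. 2 + u - (2 - u) * exp u"
  have "?g 0 < ?g u"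
  proof (rule DERIV_pos_imp_increasing_open[OF assms])
    fix t :: real assume t: "0 < t" "t < u"
    have "(?g has_real_derivative 1 - (1 - t) * exp t) (at t)"
      by (auto intro!: derivative_eq_intros simp: field_simps)
    moreover have "(1 - t) * exp t < 1"
    proof -
      have "1 - t < exp (- t)"
        using t exp_minus_greater by auto
      then show ?thesis
        by (simp add: exp_minus field_simps)
    qed
    ultimately show "\<exists>d. (?g has_real_derivative d) (at t) \<and> d > 0"
      by fastforce
  qed (intro continuous_intros)
  then show ?thesis
    by simp
qed

lemma exp_ge_two_bounds:
  fixes l :: real
  assumes "l \<ge> 2"
  shows "exp l > 7" "exp l \<ge> 3 * l"
proof -
  \<comment> \<open>41 / 32 = 1 + 1 / 4 + 1 / 32 is the quadratic Taylor value at 1 / 4.\<close>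
  have "7 < (41 / 32 :: real) ^ 8"
    by (simp add: power_divide)
  also have "\<dots> \<le> exp (1 / 4) ^ 8"
    using exp_lower_Taylor_quadratic[of "1/4"] by (intro power_mono) (auto simp: power2_eq_square)
  also have "\<dots> = exp 2"
    by (simp flip: exp_of_nat_mult)
  finally have e: "7 < exp (2::real)" .
  also have "\<dots> \<le> exp l"
    using assms by simp
  finally show "exp l > 7" .
  have "3 * l \<le> 7 * (1 + (l - 2))"
    using assms by simp
  also have "\<dots> \<le> exp 2 * exp (l - 2)"
    using e assms exp_ge_add_one_self[of "l - 2"] by (intro mult_mono) auto
  finally show "exp l \<ge> 3 * l"
    by (simp flip: exp_add)
qed

section \<open>Comparing a positive number with W0\<close>

lemma less_ln_iff:
  fixes x y :: real
  assumes "x > 0"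
  shows "y < ln x \<longleftrightarrow> exp y < x" "ln x < y \<longleftrightarrow> x < exp y"
  using assms by (metis exp_less_cancel_iff exp_ln)+

lemma mult_exp_mono_strict:
  fixes a b :: real
  assumes "0 \<le> a" "a < b"
  shows "a * exp a < b * exp b"
  using assms by (intro mult_strict_mono) auto

lemma W0_unique:
  assumes "x > 0" "w > 0" "w * exp w = x"
  shows "W0 x = w"
  unfolding W0_def
proof (rule the_equality)
  fix v :: real
  assume v: "v \<ge> - 1 \<and> v * exp v = x"
  \<comment> \<open>The branch condition only gives v \<ge> -1, while
    \<open>mult_exp_mono_strict\<close> needs nonnegative arguments; the sign of x closes the
    gap.\<close>
  then have "v > 0"
    using assms(1) by (metis exp_gt_zero zero_less_mult_pos2)
  then show "v = w"
    using v assms mult_exp_mono_strict[of v w] mult_exp_mono_strict[of w v]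
    by (metis less_eq_real_def linorder_neqE_linordered_idom less_irrefl)
qed (use assms in auto)

lemma W0_pos_eq:
  assumes "x > 0"
  shows "W0 x > 0" "W0 x * exp (W0 x) = x"
proof -
  have "\<exists>w. 0 \<le> w \<and> w \<le> x \<and> w * exp w = x"
    using assms by (intro IVT') (auto intro!: continuous_intros)
  then obtain w where w: "0 \<le> w" "w * exp w = x"
    by blast
  then have "w > 0"
    using assms by (cases "w = 0") auto
  with w assms W0_unique show "W0 x > 0" "W0 x * exp (W0 x) = x"
    by auto
qed

lemma W0_less_iff:
  assumes "x > 0" "a > 0"
  shows "W0 x < a \<longleftrightarrow> x < a * exp a"
  using W0_pos_eq[OF assms(1)] mult_exp_mono_strict[of a "W0 x"]
    mult_exp_mono_strict[of "W0 x" a] assms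
  by (smt (verit))

lemma less_W0_iff:
  assumes "x > 0" "a > 0"
  shows "a < W0 x \<longleftrightarrow> a * exp a < x"
  using W0_pos_eq[OF assms(1)] mult_exp_mono_strict[of a "W0 x"]
    mult_exp_mono_strict[of "W0 x" a] assms
  by (smt (verit))

text \<open>For a = y - ln y + P, the product a * exp a is exp y times (a / y) / exp (- P), so
  comparing it with exp y amounts to comparing that quotient with 1.\<close>

lemma W0_exp_compare:
  assumes "y > 0" "y - ln y + P > 0"
  shows "W0 (exp y) < y - ln y + P \<longleftrightarrow> exp (- P) < (y - ln y + P) / y"
    and "y - ln y + P < W0 (exp y) \<longleftrightarrow> (y - ln y + P) / y < exp (- P)"
proof -
  have "exp (y - ln y + P) = exp y / (y * exp (- P))"
    using assms by (simp add: exp_add exp_diff exp_minus field_simps)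
  then have eq: "(y - ln y + P) * exp (y - ln y + P)
      = exp y * (((y - ln y + P) / y) / exp (- P))"
    by simp
  have *: "1 < b / exp (- P) \<longleftrightarrow> exp (- P) < b" "b / exp (- P) < 1 \<longleftrightarrow> b < exp (- P)"
    "exp y < exp y * b \<longleftrightarrow> 1 < b" "exp y * b < exp y \<longleftrightarrow> b < 1" for b :: real
    by (simp_all add: less_divide_eq_1 divide_less_eq_1)
  show "W0 (exp y) < y - ln y + P \<longleftrightarrow> exp (- P) < (y - ln y + P) / y"
    unfolding W0_less_iff[OF exp_gt_zero assms(2)] eq * ..
  show "y - ln y + P < W0 (exp y) \<longleftrightarrow> (y - ln y + P) / y < exp (- P)"
    unfolding less_W0_iff[OF exp_gt_zero assms(2)] eq * ..
qed

section \<open>The normalised second-order Taylor remainder of exp (- u)\<close>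

definition exp_remainder :: "real \<Rightarrow> real" where
  "exp_remainder u = (exp (- u) - 1 + u) / u\<^sup>2"

text \<open>Behind this is the integral of (1 - s) * exp (- s * u) over s from 0 to 1, visibly
  decreasing in u; the proof differentiates the quotient instead. At u = 0 division yields the
  default 0 rather than the limit 1 / 2, hence the restriction to u > 0.\<close>

lemma exp_remainder_antimono:
  assumes "0 < u" "u \<le> v"
  shows "exp_remainder v \<le> exp_remainder u"
proof (rule DERIV_nonpos_imp_nonincreasing[OF assms(2)])
  fix t assume "u \<le> t" "t \<le> v"
  then have t: "t > 0"
    using assms by simp
  have "(exp_remainder has_real_derivative
      ((1 - exp (- t)) * t\<^sup>2 - (exp (- t) - 1 + t) * (2 * t)) / (t\<^sup>2 * t\<^sup>2)) (at t)"
    unfolding exp_remainder_def[abs_def] using t by (auto intro!: derivative_eq_intros)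
  moreover have "((1 - exp (- t)) * t\<^sup>2 - (exp (- t) - 1 + t) * (2 * t))
      = t * exp (- t) * ((2 - t) * exp t - (2 + t))"
    by (simp add: exp_minus field_simps power2_eq_square)
  moreover have "\<dots> \<le> 0"
    using t two_minus_mult_exp_less[OF t] by (intro mult_nonneg_nonpos) auto
  ultimately show "\<exists>d. (exp_remainder has_real_derivative d) (at t) \<and> d \<le> 0"
    by (metis divide_nonpos_nonneg mult_nonneg_nonneg zero_le_power2)
qed

lemma exp_remainder_bounds:
  assumes "u > 0"
  shows "1 / 2 - u / 6 \<le> exp_remainder u" "exp_remainder u \<le> 1 / 2"
proof -
  show "1 / 2 - u / 6 \<le> exp_remainder u"
    using assms exp_minus_ge_cubic[of u]
    by (simp add: exp_remainder_def field_simps power2_eq_square power3_eq_cube)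
  show "exp_remainder u \<le> 1 / 2"
    using assms exp_minus_le_quadratic[of u]
    by (simp add: exp_remainder_def field_simps)
qed

section \<open>The sign of \<open>f1\<close> and its root\<close>

lemma f1_factor:
  assumes "y > 0"
  shows "f1 y = y\<^sup>2 * exp (ln y / y) * ((y - ln y + ln y / y) / y - exp (- (ln y / y)))"
  using assms by (simp add: f1_def powr_def exp_minus field_simps power2_eq_square)

lemma f1_sign_W0:
  assumes "y \<ge> 1"
  shows "f1 y > 0 \<longleftrightarrow> W0 (exp y) < y - ln y + ln y / y"
    and "f1 y < 0 \<longleftrightarrow> y - ln y + ln y / y < W0 (exp y)"
proof -
  have "y - ln y + ln y / y > 0"
    using assms ln_less_self[of y] by (intro add_pos_nonneg) auto
  moreover have "y\<^sup>2 * exp (ln y / y) > 0"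
    using assms by simp
  ultimately show "f1 y > 0 \<longleftrightarrow> W0 (exp y) < y - ln y + ln y / y"
    and "f1 y < 0 \<longleftrightarrow> y - ln y + ln y / y < W0 (exp y)"
    using assms by (simp_all add: W0_exp_compare f1_factor zero_less_mult_iff mult_less_0_iff)
qed

text \<open>With u = ln y / y, the last factor in \<open>f1_factor\<close> is u / y - u^2 *
  \<open>exp_remainder u\<close>, and u^2 = (u / y) * ln y lets u / y be pulled out.\<close>

lemma f1_sign_exp_remainder:
  assumes "y > 1"
  shows "f1 y \<le> 0 \<longleftrightarrow> ln y * exp_remainder (ln y / y) \<ge> 1"
    and "f1 y < 0 \<longleftrightarrow> ln y * exp_remainder (ln y / y) > 1"
proof -
  have l: "ln y > 0"
    using assms by simp
  define c where "c = exp (ln y / y) * ln y"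
  have "f1 y = c * (1 - ln y * exp_remainder (ln y / y))"
    using assms l
    by (simp add: c_def f1_factor exp_remainder_def exp_minus field_simps power2_eq_square)
  moreover have "c > 0"
    using l by (simp add: c_def)
  ultimately show "f1 y \<le> 0 \<longleftrightarrow> ln y * exp_remainder (ln y / y) \<ge> 1"
    and "f1 y < 0 \<longleftrightarrow> ln y * exp_remainder (ln y / y) > 1"
    by (simp_all add: mult_le_0_iff mult_less_0_iff)
qed

lemma ln_over_self_antimono:
  fixes a b :: real
  assumes "exp 1 \<le> a" "a \<le> b"
  shows "ln b / b \<le> ln a / a"
proof -
  have a: "a > 0"
    using assms(1) exp_gt_zero[of "1::real"] by linarith
  have l: "ln a \<ge> 1"
    using assms(1) a by (simp add: ln_ge_iff)
  \<comment> \<open>The tangent bound for ln (b / a), together with ln a \<ge> 1, replaces a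
    derivative argument.\<close>
  have "ln b - ln a \<le> b / a - 1"
    using assms a ln_le_minus_one[of "b / a"] by (simp add: ln_div)
  then have "a * ln b \<le> a * ln a + (b - a) * 1"
    using a by (simp add: field_simps)
  also have "\<dots> \<le> a * ln a + (b - a) * ln a"
    using assms l by (intro add_left_mono mult_left_mono) auto
  finally show ?thesis
    using a assms by (simp add: field_simps)
qed

lemma f1_nonpos_imp_ln_ge_two:
  assumes "y > 1" "f1 y \<le> 0"
  shows "ln y \<ge> 2"
proof -
  have l: "ln y > 0" "ln y / y > 0"
    using assms by simp_all
  have "1 \<le> ln y * exp_remainder (ln y / y)"
    using assms by (simp add: f1_sign_exp_remainder)
  also have "\<dots> \<le> ln y * (1 / 2)"
    using l exp_remainder_bounds(2) by (intro mult_left_mono) auto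
  finally show ?thesis
    by simp
qed

text \<open>A single-crossing principle: from a on, ln y increases strictly, and
  \<open>exp_remainder (ln y / y)\<close> does not decrease because its argument does not increase
  beyond exp 1. So their product, once at least 1, then exceeds 1.\<close>

lemma f1_neg_beyond_nonpos:
  assumes "a > 1" "f1 a \<le> 0" "a < b"
  shows "f1 b < 0"
proof -
  have l: "ln a \<ge> 2" "ln a < ln b"
    using assms f1_nonpos_imp_ln_ge_two by auto
  then have a: "exp 1 \<le> a"
    using assms by (simp flip: ln_ge_iff)
  have "0 < ln b / b"
    using assms by simp
  then have "exp_remainder (ln a / a) \<le> exp_remainder (ln b / b)"
    using ln_over_self_antimono[OF a] assms by (intro exp_remainder_antimono) auto
  moreover have "1 \<le> ln a * exp_remainder (ln a / a)"
    using assms by (simp add: f1_sign_exp_remainder)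
  moreover from this have "exp_remainder (ln a / a) > 0"
    using l by (smt (verit) mult_nonneg_nonpos)
  ultimately have "1 < ln b * exp_remainder (ln b / b)"
    using l by (smt (verit) mult_left_mono mult_strict_right_mono)
  then show ?thesis
    using assms by (simp add: f1_sign_exp_remainder)
qed

lemma f1_root:
  obtains y0 where "y0 \<ge> exp 2" "x_star = exp y0" "f1 y0 = 0"
    "\<And>y. 1 < y \<Longrightarrow> y < y0 \<Longrightarrow> f1 y > 0" "\<And>y. y0 < y \<Longrightarrow> f1 y < 0"
proof -
  have gt1: "exp t > 1" if "t > 0" for t :: real
    using that by simp
  have "f1 (exp 3) \<le> 0"
  proof -
    define u where "u = 3 / exp (3::real)"
    have "0 < u" "u \<le> 1 / 3"
      using exp_ge_two_bounds(2)[of 3] by (auto simp: u_def field_simps)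
    \<comment> \<open>The lower bound for the remainder is at least 1 / 2 - 1 / 18 = 4 / 9.\<close>
    then have "1 \<le> 3 * exp_remainder u"
      using exp_remainder_bounds(1)[of u] by linarith
    then show ?thesis
      by (simp add: f1_sign_exp_remainder u_def)
  qed
  moreover have "f1 (exp 2) \<ge> 0"
  proof (rule ccontr)
    assume "\<not> f1 (exp 2) \<ge> 0"
    then have "1 < 2 * exp_remainder (2 / exp 2)"
      using f1_sign_exp_remainder(2)[of "exp 2"] by simp
    with exp_remainder_bounds(2)[of "2 / exp 2"] show False
      by simp
  qed
  moreover have "continuous_on {exp 2..exp 3} f1"
    unfolding f1_def[abs_def]
    by (intro continuous_intros) (auto simp: not_le intro: less_le_trans[OF exp_gt_zero])
  ultimately obtain y0 where y0: "exp 2 \<le> y0" "f1 y0 = 0"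
    using IVT2'[of f1 "exp 3" 0 "exp 2"] by auto
  have "y0 > 1"
    using y0(1) gt1[of 2] by linarith
  have neg: "f1 y < 0" if "y0 < y" for y
    using f1_neg_beyond_nonpos[OF \<open>y0 > 1\<close>] y0 that by simp
  \<comment> \<open>A nonpositive value before \<open>y0\<close> would force \<open>f1 y0\<close> to
    be negative.\<close>
  have pos: "f1 y > 0" if "1 < y" "y < y0" for y
    using f1_neg_beyond_nonpos[OF that(1) _ that(2)] y0(2) by force
  have "(THE y. y > 1 \<and> f1 y = 0) = y0"
    using \<open>y0 > 1\<close> y0(2) neg pos by (intro the_equality) (auto, metis less_irrefl linorder_neqE)
  with that y0 neg pos show thesis
    by (auto simp: x_star_def)
qed

section \<open>The sign of \<open>f2\<close> and its root\<close>

lemma f2_pos_beyond_nonneg: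
  assumes "a > 1" "f2 a \<ge> 0" "a < b"
  shows "f2 b > 0"
proof -
  have "a > 3"
  proof (rule ccontr)
    assume "\<not> a > 3"
    then have "(a - 3) * ln a \<le> 0"
      using assms by (intro mult_nonpos_nonneg) auto
    with assms show False
      by (simp add: f2_def)
  qed
  \<comment> \<open>For y > 3, \<open>f2 y\<close> is nonnegative iff ln y \<ge> 2 + 6 / (y - 3);
    the left side increases and the right side decreases.\<close>
  have "2 + 6 / (b - 3) < 2 + 6 / (a - 3)"
    using \<open>a > 3\<close> assms by (simp add: field_simps)
  also have "\<dots> \<le> ln a"
    using \<open>a > 3\<close> assms by (simp add: f2_def field_simps)
  also have "\<dots> < ln b"
    using assms by simp
  finally show ?thesis
    using \<open>a > 3\<close> assms by (simp add: f2_def field_simps)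
qed

lemma f2_root:
  obtains y0 where "y0 \<ge> exp 2" "x_star_star = exp y0"
    "\<And>y. 1 < y \<Longrightarrow> y < y0 \<Longrightarrow> f2 y < 0" "\<And>y. y0 < y \<Longrightarrow> f2 y > 0"
proof -
  \<comment> \<open>The values at exp 2 and exp 3 are -6 and exp 3 - 9.\<close>
  have "f2 (exp 2) \<le> 0"
    by (simp add: f2_def)
  moreover have "f2 (exp 3) \<ge> 0"
    using exp_ge_two_bounds(2)[of 3] by (simp add: f2_def)
  moreover have "continuous_on {exp 2..exp 3} f2"
    unfolding f2_def[abs_def]
    by (intro continuous_intros) (auto simp: not_le intro: less_le_trans[OF exp_gt_zero])
  ultimately obtain y0 where y0: "exp 2 \<le> y0" "f2 y0 = 0"
    using IVT'[of f2 "exp 2" 0 "exp 3"] by auto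
  have "y0 > 1"
    using y0(1) exp_ge_two_bounds(1)[of 2] by linarith
  have pos: "f2 y > 0" if "y0 < y" for y
    using f2_pos_beyond_nonneg[OF \<open>y0 > 1\<close>] y0 that by simp
  have neg: "f2 y < 0" if "1 < y" "y < y0" for y
    using f2_pos_beyond_nonneg[OF that(1) _ that(2)] y0(2) by force
  have "(THE y. y > 1 \<and> f2 y = 0) = y0"
    using \<open>y0 > 1\<close> y0(2) neg pos by (intro the_equality) (auto, metis less_irrefl linorder_neqE)
  with that y0 neg pos show thesis
    by (auto simp: x_star_star_def)
qed

section \<open>Polynomial estimates for the refined corrections\<close>

lemma upper_correction_exp_bound:
  fixes u q :: real
  assumes "0 < u" "u \<le> 1 / 3" "0 < q" "q \<le> u / 2"
  defines "P \<equiv> u + u\<^sup>2 / 2 + u ^ 3 - u * q"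
  shows "P > 0" "exp (- P) < 1 - u + q * P"
proof -
  \<comment> \<open>The relative deviation of P from its leading term u; it is of order u.\<close>
  define d where "d = u / 2 + u\<^sup>2 - q"
  have P: "P = u * (1 + d)"
    by (simp add: P_def d_def field_simps power2_eq_square power3_eq_cube)
  have "u\<^sup>2 \<le> u / 3"
    using assms by (simp add: power2_eq_square)
  then have "\<bar>d\<bar> \<le> 5 / 6 * u"
    using assms zero_le_power2[of u] unfolding d_def by linarith
  then have "d\<^sup>2 \<le> (5 / 6 * u)\<^sup>2"
    using assms by (intro abs_le_square_iff[THEN iffD1]) auto
  then have "u * d\<^sup>2 \<le> 1 / 3 * (5 / 6 * u)\<^sup>2"
    using assms by (intro mult_mono) auto
  then have ud: "u * d\<^sup>2 / 2 \<le> 25 / 216 * u\<^sup>2"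
    by (simp add: power_mult_distrib power_divide)
  show "P > 0"
    using assms \<open>\<bar>d\<bar> \<le> 5 / 6 * u\<close> unfolding P by (intro mult_pos_pos) auto
  have "0 < u\<^sup>2"
    using assms by simp
  have "u ^ 3 \<le> u\<^sup>2 / 3"
    using assms by (simp add: power2_eq_square power3_eq_cube)
  moreover have "q\<^sup>2 \<le> q * u"
    using assms by (simp add: power2_eq_square)
  moreover have "0 \<le> q * u" "0 \<le> q * u\<^sup>2"
    using assms by auto
  \<comment> \<open>The u^2 budget is 1 / 2 - 1 / 3 - 25 / 216 > 0, and q * u absorbs q^2. Times u,
    this is the gap between 1 - u + q * P and the quadratic bound for exp (- P).\<close>
  ultimately have "0 < u\<^sup>2 / 2 - u ^ 3 + 3 / 2 * (q * u) + q * u\<^sup>2 - q\<^sup>2 - u * d\<^sup>2 / 2"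
    using ud \<open>0 < u\<^sup>2\<close> by linarith
  then have "0 < u * (u\<^sup>2 / 2 - u ^ 3 + 3 / 2 * (q * u) + q * u\<^sup>2 - q\<^sup>2 - u * d\<^sup>2 / 2)"
    using assms by simp
  also have "\<dots> = (1 - u + q * P) - (1 - P + P\<^sup>2 / 2)"
    unfolding P d_def by (simp add: field_simps power2_eq_square power3_eq_cube)
  finally show "exp (- P) < 1 - u + q * P"
    using exp_minus_le_quadratic[of P] \<open>P > 0\<close> by linarith
qed

text \<open>Writing Q = u * p, the cubic Taylor bound for exp (- Q) exceeds 1 - u + q * Q by
  nonnegative terms plus a multiple of 3 * (1 - q) * (1 - 3 * q) - p^3, so it suffices that p^3 is
  smaller than that product.\<close>

lemma lower_correction_exp_bound:
  fixes u q :: real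
  assumes "0 < u" "u \<le> 1 / 3" "0 < q" "q < 1 / 7"
  defines "Q \<equiv> u + u\<^sup>2 / 2 - u * q - 3 / 2 * u\<^sup>2 * q"
  shows "Q > 0" "1 - u + q * Q < exp (- Q)"
proof -
  define p where "p = (1 - q) + u * (1 - 3 * q) / 2"
  have Q: "Q = u * p"
    by (simp add: Q_def p_def field_simps power2_eq_square)
  have p: "p > 0"
    using assms unfolding p_def by (intro add_pos_nonneg) auto
  then show "Q > 0"
    using assms(1) by (simp add: Q)
  have "u * (1 - 3 * q) \<le> 1 / 3 * (1 - q)"
    using assms by (intro mult_mono) auto
  then have "p \<le> (1 - q) * (7 / 6)"
    unfolding p_def by simp
  then have "p ^ 3 \<le> ((1 - q) * (7 / 6)) ^ 3"
    using p by (intro power_mono) auto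
  also have "\<dots> = (1 - q) * (1 - q)\<^sup>2 * (343 / 216)"
    by (simp add: field_simps power2_eq_square power3_eq_cube)
  also have "\<dots> \<le> (1 - q) * 1 * (343 / 216)"
    using assms by (intro mult_right_mono mult_left_mono power_le_one) auto
  \<comment> \<open>q < 1 / 7 gives 3 * (1 - 3 * q) > 12 / 7, which exceeds (7 / 6)^3 = 343 /
    216.\<close>
  also have "\<dots> < (1 - q) * (3 * (1 - 3 * q))"
    unfolding mult_1_right using assms(3,4) by (intro mult_strict_left_mono) auto
  finally have "0 < u ^ 3 * ((1 - q) * (3 * (1 - 3 * q)) - p ^ 3) / 6"
    using assms(1) by (intro divide_pos_pos mult_pos_pos) auto
  also have "\<dots> \<le> u ^ 3 * ((1 - q) * (3 * (1 - 3 * q)) - p ^ 3) / 6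
      + (2 * u\<^sup>2 * q\<^sup>2 + u * q\<^sup>2 + (u\<^sup>2 * (1 - 3 * q))\<^sup>2 / 8)"
    using assms by (simp add: add_nonneg_nonneg)
  also have "\<dots> = (1 - Q + Q\<^sup>2 / 2 - Q ^ 3 / 6) - (1 - u + q * Q)"
    unfolding Q p_def by (simp add: field_simps power2_eq_square power3_eq_cube)
  finally show "1 - u + q * Q < exp (- Q)"
    using exp_minus_ge_cubic[of Q] \<open>Q > 0\<close> by linarith
qed

section \<open>The refined bounds in terms of y = ln x\<close>

lemma W0_exp_upper_bound:
  assumes "ln y > 2" "y > 0"
  shows "W0 (exp y) < y - ln y + ln y / y + (ln y - 2) * ln y / (2 * y\<^sup>2) + (ln y) ^ 3 / y ^ 3"
proof -
  define u q where "u = ln y / y" and "q = 1 / y"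
  \<comment> \<open>u^2 / 2 - u * q is the term with denominator 2 * y^2.\<close>
  define P where "P = u + u\<^sup>2 / 2 + u ^ 3 - u * q"
  have bounds: "0 < u" "u \<le> 1 / 3" "0 < q" "q \<le> u / 2"
    using assms exp_ge_two_bounds(2)[of "ln y"] by (auto simp: u_def q_def field_simps)
  note P = upper_correction_exp_bound[OF bounds, folded P_def]
  have eq: "(y - ln y + P) / y = 1 - u + q * P"
    using assms by (simp add: u_def q_def add_divide_distrib diff_divide_distrib)
  have "y - ln y + P > 0"
    using assms P(1) ln_less_self[of y] by linarith
  then have "W0 (exp y) < y - ln y + P"
    using assms P(2) eq W0_exp_compare(1) by simp
  also have "P = ln y / y + (ln y - 2) * ln y / (2 * y\<^sup>2) + (ln y) ^ 3 / y ^ 3"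
    using assms
    by (simp add: P_def u_def q_def field_simps power2_eq_square power3_eq_cube)
  finally show ?thesis
    by (simp add: add.assoc)
qed

lemma W0_exp_lower_bound:
  assumes "ln y > 2" "y > 0"
  shows "y - ln y + ln y / y + (ln y - 2) * ln y / (2 * y\<^sup>2) - 3 * (ln y)\<^sup>2 / (2 * y ^ 3)
    < W0 (exp y)"
proof -
  define u q where "u = ln y / y" and "q = 1 / y"
  define Q where "Q = u + u\<^sup>2 / 2 - u * q - 3 / 2 * u\<^sup>2 * q"
  have bounds: "0 < u" "u \<le> 1 / 3" "0 < q" "q < 1 / 7"
    using assms exp_ge_two_bounds[of "ln y"] by (auto simp: u_def q_def field_simps)
  note Q = lower_correction_exp_bound[OF bounds, folded Q_def]
  have eq: "(y - ln y + Q) / y = 1 - u + q * Q"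
    using assms by (simp add: u_def q_def add_divide_distrib diff_divide_distrib)
  have "y - ln y + Q > 0"
    using assms Q(1) ln_less_self[of y] by linarith
  then have "y - ln y + Q < W0 (exp y)"
    using assms Q(2) eq W0_exp_compare(2) by simp
  moreover have "Q = ln y / y + (ln y - 2) * ln y / (2 * y\<^sup>2) - 3 * (ln y)\<^sup>2 / (2 * y ^ 3)"
    using assms
    by (simp add: Q_def u_def q_def field_simps power2_eq_square power3_eq_cube)
  ultimately show ?thesis
    by (simp add: algebra_simps)
qed

text \<open>The origin of \<open>f2\<close>: up to a positive factor it is the extra correction in
  the refined lower bound, so its root is the exact threshold for that correction to be an
  improvement.\<close>

lemma f2_pos_iff:
  assumes "y > 1"
  shows "f2 y > 0 \<longleftrightarrow> 0 < (ln y - 2) * ln y / (2 * y\<^sup>2) - 3 * (ln y)\<^sup>2 / (2 * y ^ 3)"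
proof -
  have "(ln y - 2) * ln y / (2 * y\<^sup>2) - 3 * (ln y)\<^sup>2 / (2 * y ^ 3) = ln y / (2 * y ^ 3) * f2 y"
    using assms by (simp add: f2_def field_simps power2_eq_square power3_eq_cube)
  moreover have "ln y / (2 * y ^ 3) > 0"
    using assms by simp
  ultimately show ?thesis
    by (metis mult_pos_pos zero_less_mult_pos)
qed

section \<open>Transfer from y back to x\<close>

theorem theorem2p3:
  shows
    "((\<forall>x\<in>{exp 1<..<x_star}. L1 x - L2 x + L2 x / L1 x > W0 x) \<and>
     (\<forall>x\<in>{exp 1, x_star}. L1 x - L2 x + L2 x / L1 x = W0 x) \<and>
     (\<forall>x\<in>{x_star<..}. L1 x - L2 x + L2 x / L1 x < W0 x)) \<and>
     (\<forall>x\<in>{x_star<..}.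
       W0 x < L1 x - L2 x + L2 x / L1 x + (L2 x - 2) * L2 x / (2 * (L1 x)^2)
                + (L2 x)^3 / (L1 x)^3) \<and>
     ((\<forall>x\<in>{x_star_star<..}.
        L1 x - L2 x + L2 x / L1 x
          < L1 x - L2 x + L2 x / L1 x + (L2 x - 2) * L2 x / (2 * (L1 x)^2)
              - 3 * (L2 x)^2 / (2 * (L1 x)^3) \<and>
        L1 x - L2 x + L2 x / L1 x + (L2 x - 2) * L2 x / (2 * (L1 x)^2)
              - 3 * (L2 x)^2 / (2 * (L1 x)^3)
          < W0 x) \<and>
     (let S = {x0. x0 > exp 1 \<and>
                 (\<forall>x\<in>{x0<..}. L1 x - L2 x + L2 x / L1 x
                    < L1 x - L2 x + L2 x / L1 x + (L2 x - 2) * L2 x / (2 * (L1 x)^2)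
                        - 3 * (L2 x)^2 / (2 * (L1 x)^3))}
      in x_star_star \<in> S \<and> (\<forall>x0\<in>S. x_star_star \<le> x0)))"
proof -
  obtain y1 where y1: "y1 \<ge> exp 2" "x_star = exp y1" "f1 y1 = 0"
    "\<And>y. 1 < y \<Longrightarrow> y < y1 \<Longrightarrow> f1 y > 0" "\<And>y. y1 < y \<Longrightarrow> f1 y < 0"
    by (rule f1_root) blast
  obtain y2 where y2: "y2 \<ge> exp 2" "x_star_star = exp y2"
    "\<And>y. 1 < y \<Longrightarrow> y < y2 \<Longrightarrow> f2 y < 0" "\<And>y. y2 < y \<Longrightarrow> f2 y > 0"
    by (rule f2_root) blast
  have gt1: "y1 > 1" "y2 > 1"
    using y1(1) y2(1) exp_ge_two_bounds(1)[of 2] by linarith+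
  \<comment> \<open>Both roots are at least exp 2, so beyond either threshold ln (ln x) > 2, as the
    refined bounds require.\<close>
  have ln_gt: "ln x > y" "ln (ln x) > 2" "exp (ln x) = x" "x > 1" if "exp y < x" "y \<ge> exp 2" for x y :: real
  proof -
    have "x > 0"
      using that(1) exp_gt_zero[of y] by linarith
    then show "exp (ln x) = x" "ln x > y"
      using that(1) by (simp_all add: less_ln_iff)
    then have "ln x > exp 2"
      using that(2) by linarith
    moreover from this show "x > 1"
      using \<open>x > 0\<close> exp_gt_zero[of "2::real"] by (subst ln_gt_zero_iff[symmetric]) linarith+
    ultimately show "ln (ln x) > 2"
      using exp_gt_zero[of "2::real"] by (subst less_ln_iff) linarith+
  qed
  have part1a: "L1 x - L2 x + L2 x / L1 x > W0 x" if "x \<in> {exp 1<..<x_star}" for x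
  proof -
    have "x > 0"
      using that exp_gt_zero[of "1::real"] by (smt (verit) greaterThanLessThan_iff)
    then have "1 < ln x" "ln x < y1"
      using that y1(2) by (auto simp: less_ln_iff)
    then show ?thesis
      using f1_sign_W0(1)[of "ln x"] y1(4) \<open>x > 0\<close> by (simp add: L1_def L2_def)
  qed
  have part1b: "L1 x - L2 x + L2 x / L1 x = W0 x" if "x \<in> {exp 1, x_star}" for x
  proof -
    \<comment> \<open>The spurious root y = 1 of \<open>f1\<close> accounts for equality at x = exp
      1.\<close>
    have "f1 1 = 0"
      by (simp add: f1_def)
    then obtain y where "x = exp y" "y \<ge> 1" "f1 y = 0"
      using \<open>x \<in> {exp 1, x_star}\<close> y1(2,3) gt1(1) by auto
    then show ?thesis
      using f1_sign_W0[of y] by (simp add: L1_def L2_def)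
  qed
  have part1c: "L1 x - L2 x + L2 x / L1 x < W0 x" if "x \<in> {x_star<..}" for x
    using ln_gt[of y1 x] that y1 gt1 f1_sign_W0(2)[of "ln x"] by (simp add: L1_def L2_def)
  have part2: "W0 x < L1 x - L2 x + L2 x / L1 x + (L2 x - 2) * L2 x / (2 * (L1 x)^2)
      + (L2 x)^3 / (L1 x)^3" if "x \<in> {x_star<..}" for x
    using ln_gt[of y1 x] that y1 gt1 W0_exp_upper_bound[of "ln x"] by (simp add: L1_def L2_def)
  have part3: "L1 x - L2 x + L2 x / L1 x + (L2 x - 2) * L2 x / (2 * (L1 x)^2)
      - 3 * (L2 x)^2 / (2 * (L1 x)^3) < W0 x" if "x \<in> {x_star_star<..}" for x
    using ln_gt[of y2 x] that y2 gt1 W0_exp_lower_bound[of "ln x"] by (simp add: L1_def L2_def)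
  have first_iff: "L1 x - L2 x + L2 x / L1 x
      < L1 x - L2 x + L2 x / L1 x + (L2 x - 2) * L2 x / (2 * (L1 x)^2)
        - 3 * (L2 x)^2 / (2 * (L1 x)^3) \<longleftrightarrow> f2 (ln x) > 0" if "ln x > 1" for x
    using f2_pos_iff[OF that] by (simp add: L1_def L2_def)
  have first: "L1 x - L2 x + L2 x / L1 x
      < L1 x - L2 x + L2 x / L1 x + (L2 x - 2) * L2 x / (2 * (L1 x)^2)
        - 3 * (L2 x)^2 / (2 * (L1 x)^3)" if "x \<in> {x_star_star<..}" for x
    using ln_gt[of y2 x] that y2 gt1 by (subst first_iff) auto
  have minimal: "x_star_star \<le> x0" if x0: "x0 > exp 1"
    "\<forall>x\<in>{x0<..}. L1 x - L2 x + L2 x / L1 x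
      < L1 x - L2 x + L2 x / L1 x + (L2 x - 2) * L2 x / (2 * (L1 x)^2)
        - 3 * (L2 x)^2 / (2 * (L1 x)^3)" for x0
  proof (rule ccontr)
    assume "\<not> x_star_star \<le> x0"
    \<comment> \<open>Any such x has 1 < ln x < \<open>y2\<close>, where \<open>f2\<close> is
      negative and the first inequality fails.\<close>
    then obtain x where x: "x0 < x" "x < exp y2"
      using y2(2) dense[of x0 x_star_star] by auto
    then have "exp 1 < x" "x > 0"
      using x0(1) exp_gt_zero[of "1::real"] by linarith+
    then have "1 < ln x" "ln x < y2"
      using x by (auto simp: less_ln_iff)
    then show False
      using first_iff[of x] x0(2) x(1) y2(3)[of "ln x"] by auto
  qed
  have "x_star_star > exp 1"
    using gt1(2) unfolding y2(2) by simp
  then show ?thesis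
    using part1a part1b part1c part2 part3 first minimal unfolding Let_def by blast
qed

end
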